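(* Let $\mathcal{X}\subset\mathbb{S}^{d-1}$ be the input domain and suppose the observation noise is i.i.d. zero-mean Gaussian with variance $\sigma^2>0$. Then the maximum information gain $\gamma_T$ associated with the neural tangent kernel $k_{\mathrm{NN}}$ of a fully-connected ReLU network with $L$ hidden layers satisfies, as $T\to\infty$, $$\gamma_T=\mathcal{O}\left(\left(\frac{C(d,L)\,T}{\log(1+\frac{T}{\sigma^2})}\right)^{\frac{d-1}{d}}\log\left(1+\frac{T}{\sigma^2}\left(\frac{C(d,L)\,T}{\log(1+\frac{T}{\sigma^2})}\right)^{\frac{d-1}{d}}\right)\right).$$
   Context: $\mathbb{S}^{d-1}=\{x\in\mathbb{R}^d:\|x\|_2=1\}$. Neural tangent kernel (NTK): consider the fully-connected ReLU network with $L$ hidden layers of width $m$, $f^{(1)}(x)=W^{(1)}x$, $f^{(l)}(x)=\sqrt{2/m}\,W^{(l)}\sigma_{\mathrm{relu}}(f^{(l-1)}(x))\in\mathbb{R}^m$ for $1<l\le L$, $f(x;\theta)=\sqrt2\,W^{(L+1)}\sigma_{\mathrm{relu}}(f^{(L)}(x))\in\mathbb{R}$, $\theta=(W^{(i)})_{i\le L+1}$ with i.i.d. standard normal entries, and $g(x;\theta)=\nabla_\theta f(x;\theta)$. The NTK is the deterministic limit $k_{\mathrm{NN}}(x,x')=\lim_{m\to\infty}\langle g(x;\theta),g(x';\theta)\rangle/m$. On $\mathbb{S}^{d-1}$ with the uniform measure it has the (known) Mercer decomposition $k_{\mathrm{NN}}(x,x')=\sum_{k\ge0}\mu_k\sum_{j=1}^{N(d,k)}Y_{j,k}(x)Y_{j,k}(x')$,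 where $Y_{j,k}$ is the $j$-th spherical harmonic of degree $k$, $N(d,k)=\frac{2k+d-2}{k}\binom{k+d-3}{d-2}$ for $k\ge1$ is the number of such harmonics, and the known eigenvalue decay is $\mu_k\simeq C(d,L)k^{-d}$; this defines the constant $C(d,L)$. For a sequence $X_T=(x_1,\dots,x_T)$ in $\mathcal{X}$, with $f\sim\mathrm{GP}(0,k_{\mathrm{NN}})$, true values $\mathbf f_T=(f(x_1),\dots,f(x_T))$ and noisy observations $\mathbf y_T=\mathbf f_T+$ i.i.d. $\mathcal N(0,\sigma^2)$ noise, the information gain is the mutual information $I(\mathbf y_T;\mathbf f_T)=\frac12\log\det(I+\sigma^{-2}K_T)$, where $K_T=[k_{\mathrm{NN}}(x_i,x_j)]_{i,j\le T}$. The maximum information gain is $\gamma_T=\max_{X_T}I(\mathbf y_T;\mathbf f_T)$, over all sequences of length $T$ in $\mathcal{X}$. *)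

theory Defs
  imports
    "HOL-Probability.Probability"
    "HOL-Library.Landau_Symbols"
    "Jordan_Normal_Form.Determinant"
begin

subsection \<open>The fully-connected ReLU network and its tangent kernel\<close>

text \<open>
  The width tends to infinity, so the parameters cannot be indexed by a type. A parameter vector is
  a function on weight positions: \<open>W_in i j\<close> is entry \<open>(i, j)\<close> of \<open>W\<^sup>(\<^sup>1\<^sup>)\<close>, \<open>W_hid l i j\<close> is entry
  \<open>(i, j)\<close> of \<open>W\<^sup>(\<^sup>l\<^sup>)\<close> for \<open>2 \<le> l \<le> L\<close>, and \<open>W_out j\<close> is entry \<open>j\<close> of the row vector \<open>W\<^sup>(\<^sup>L\<^sup>+\<^sup>1\<^sup>)\<close>.
\<close>

datatype 'd weight = W_in nat 'd | W_hid nat nat nat | W_out nat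

definition weights :: "nat \<Rightarrow> nat \<Rightarrow> 'd weight set" where
  "weights m L =
     {W_in i j | i j. i < m} \<union>
     {W_hid l i j | l i j. 2 \<le> l \<and> l \<le> L \<and> i < m \<and> j < m} \<union>
     {W_out j | j. j < m}"

definition relu :: "real \<Rightarrow> real" where
  "relu t = max 0 t"

text \<open>
  \<open>layer m \<theta> x l i\<close> is coordinate \<open>i\<close> of \<open>f\<^sup>(\<^sup>l\<^sup>)(x)\<close>. Layers are numbered from 1; the value at \<open>l = 0\<close>
  is a placeholder.
\<close>

fun layer :: "nat \<Rightarrow> ('d::finite weight \<Rightarrow> real) \<Rightarrow> real ^ 'd \<Rightarrow> nat \<Rightarrow> nat \<Rightarrow> real" where
  "layer m \<theta> x 0 i = 0"
| "layer m \<theta> x (Suc 0) i = (\<Sum>j\<in>UNIV. \<theta> (W_in i j) * vec_nth x j)"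
| "layer m \<theta> x (Suc (Suc l)) i =
     sqrt (2 / real m) *
       (\<Sum>j<m. \<theta> (W_hid (Suc (Suc l)) i j) * relu (layer m \<theta> x (Suc l) j))"

definition network :: "nat \<Rightarrow> nat \<Rightarrow> ('d::finite weight \<Rightarrow> real) \<Rightarrow> real ^ 'd \<Rightarrow> real" where
  "network m L \<theta> x = sqrt 2 * (\<Sum>j<m. \<theta> (W_out j) * relu (layer m \<theta> x L j))"

text \<open>
  For \<open>x \<noteq> 0\<close> the network is differentiable in \<open>\<theta>\<close> outside a null set of parameters, so the
  arbitrary value of \<^const>\<open>deriv\<close> at kinks does not affect the limit below.
\<close>

definition gradient ::
    "nat \<Rightarrow> nat \<Rightarrow> ('d::finite weight \<Rightarrow> real) \<Rightarrow> real ^ 'd \<Rightarrow> 'd weight \<Rightarrow> real" where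
  "gradient m L \<theta> x w = deriv (\<lambda>t. network m L (\<theta>(w := t)) x) (\<theta> w)"

definition empirical_ntk ::
    "nat \<Rightarrow> nat \<Rightarrow> ('d::finite weight \<Rightarrow> real) \<Rightarrow> real ^ 'd \<Rightarrow> real ^ 'd \<Rightarrow> real" where
  "empirical_ntk m L \<theta> x x' =
     (\<Sum>w\<in>weights m L. gradient m L \<theta> x w * gradient m L \<theta> x' w) / real m"

definition init_measure :: "nat \<Rightarrow> nat \<Rightarrow> ('d::finite weight \<Rightarrow> real) measure" where
  "init_measure m L = PiM (weights m L) (\<lambda>_. density lborel std_normal_density)"

text \<open>The deterministic limit is a limit in probability, on the sphere.\<close>

definition is_ntk :: "nat \<Rightarrow> (real ^ 'd::finite \<Rightarrow> real ^ 'd \<Rightarrow> real) \<Rightarrow> bool" where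
  "is_ntk L K \<longleftrightarrow>
     (\<forall>x \<in> sphere 0 1. \<forall>x' \<in> sphere 0 1. \<forall>\<epsilon>>0.
        (\<lambda>m. measure (init_measure m L)
               {\<theta> \<in> space (init_measure m L). \<epsilon> < \<bar>empirical_ntk m L \<theta> x x' - K x x'\<bar>})
          \<longlonglongrightarrow> 0)"


subsection \<open>Spherical harmonics and the Mercer decomposition\<close>

text \<open>
  The uniform probability measure on the unit sphere, as the law of the direction of a uniformly
  distributed point of the unit ball (\<^const>\<open>sgn\<close> is \<open>x / \<parallel>x\<parallel>\<close>).
\<close>

definition uniform_sphere :: "(real ^ 'd::finite) measure" where
  "uniform_sphere = distr (uniform_measure lborel (ball 0 1)) borel sgn"

definition laplacian :: "(real ^ 'd::finite \<Rightarrow> real) \<Rightarrow> real ^ 'd \<Rightarrow> real" where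
  "laplacian p x = (\<Sum>i\<in>UNIV. (deriv ^^ 2) (\<lambda>t. p (x + t *\<^sub>R axis i 1)) 0)"

text \<open>
  A spherical harmonic of degree \<open>k\<close> is represented by its unique extension to a homogeneous harmonic
  polynomial of degree \<open>k\<close>; only its values on the sphere are used.
\<close>

definition harmonic_polys :: "nat \<Rightarrow> (real ^ 'd::finite \<Rightarrow> real) set" where
  "harmonic_polys k =
     {p. real_polynomial_function p \<and> (\<forall>c x. p (c *\<^sub>R x) = c ^ k * p x) \<and> (\<forall>x. laplacian p x = 0)}"

text \<open>
  \<open>num_harmonics d k\<close> is \<open>N(d, k)\<close>, for \<open>d \<ge> 2\<close>. The division is exact, and neither subtraction
  truncates for \<open>k \<ge> 1\<close>. The formula is not defined at \<open>k = 0\<close>, where only the constants occur.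
\<close>

definition num_harmonics :: "nat \<Rightarrow> nat \<Rightarrow> nat" where
  "num_harmonics d k =
     (if k = 0 then 1 else ((2 * k + d - 2) * ((k + d - 3) choose (d - 2))) div k)"

text \<open>
  \<open>Y j k\<close> for \<open>1 \<le> j \<le> N(d, k)\<close> is an orthonormal basis, in \<open>L\<^sup>2\<close> of the uniform measure, of the
  spherical harmonics of degree \<open>k\<close>. Linear relations between homogeneous polynomials of the same
  degree on the sphere and on the whole space are the same.
\<close>

definition spherical_harmonics_basis :: "(nat \<Rightarrow> nat \<Rightarrow> real ^ 'd::finite \<Rightarrow> real) \<Rightarrow> bool" where
  "spherical_harmonics_basis Y \<longleftrightarrow>
     (\<forall>k. \<forall>j\<in>{1..num_harmonics CARD('d) k}. Y j k \<in> harmonic_polys k) \<and>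
     (\<forall>k. \<forall>i\<in>{1..num_harmonics CARD('d) k}. \<forall>j\<in>{1..num_harmonics CARD('d) k}.
        (LINT x|uniform_sphere. Y i k x * Y j k x) = (if i = j then 1 else 0)) \<and>
     (\<forall>k. \<forall>p\<in>harmonic_polys k. \<exists>c. \<forall>x.
        p x = (\<Sum>j=1..num_harmonics CARD('d) k. c j * Y j k x))"

definition mercer_decomposition ::
    "(real ^ 'd::finite \<Rightarrow> real ^ 'd \<Rightarrow> real) \<Rightarrow> (nat \<Rightarrow> real) \<Rightarrow>
     (nat \<Rightarrow> nat \<Rightarrow> real ^ 'd \<Rightarrow> real) \<Rightarrow> bool" where
  "mercer_decomposition K \<mu> Y \<longleftrightarrow>
     (\<forall>k. 0 \<le> \<mu> k) \<and>
     (\<forall>x \<in> sphere 0 1. \<forall>x' \<in> sphere 0 1.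
        (\<lambda>k. \<mu> k * (\<Sum>j=1..num_harmonics CARD('d) k. Y j k x * Y j k x')) sums K x x')"

text \<open>
  The decay \<open>\<mu>\<^sub>k \<simeq> C k\<^sup>-\<^sup>d\<close>, with \<open>C\<close> determined by the eigenvalues. A plain limit would be wrong here:
  the constant of the neural tangent kernel of a ReLU network depends on the parity of \<open>k\<close>
  (for \<open>L = 1\<close> the odd eigenvalues from \<open>k = 3\<close> on vanish), so \<open>C\<close> is the upper limit of
  \<open>k\<^sup>d \<mu>\<^sub>k\<close>. It is the limit whenever that exists.
\<close>

definition eigenvalue_decay :: "(nat \<Rightarrow> real) \<Rightarrow> nat \<Rightarrow> real \<Rightarrow> bool" where
  "eigenvalue_decay \<mu> d C \<longleftrightarrow>
     0 < C \<and> limsup (\<lambda>k. ereal (real k ^ d * \<mu> k)) = ereal C"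


subsection \<open>Information gain\<close>

definition kernel_matrix :: "('a \<Rightarrow> 'a \<Rightarrow> real) \<Rightarrow> 'a list \<Rightarrow> real Matrix.mat" where
  "kernel_matrix K xs = Matrix.mat (length xs) (length xs) (\<lambda>(i, j). K (xs ! i) (xs ! j))"

text \<open>
  The mutual information of \<open>(f(x\<^sub>1), \<dots>, f(x\<^sub>T))\<close>, for \<open>f\<close> a centred Gaussian process with covariance
  \<open>K\<close>, and its observation under independent i.i.d. centred Gaussian noise of variance \<open>v\<close>.
\<close>

definition information_gain :: "('a \<Rightarrow> 'a \<Rightarrow> real) \<Rightarrow> real \<Rightarrow> 'a list \<Rightarrow> real" where
  "information_gain K v xs =
     1 / 2 * ln (Determinant.det (1\<^sub>m (length xs) + (1 / v) \<cdot>\<^sub>m kernel_matrix K xs))"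

text \<open>A supremum, since the maximum need not be attained when \<open>X\<close> is not closed.\<close>

definition max_information_gain :: "('a \<Rightarrow> 'a \<Rightarrow> real) \<Rightarrow> real \<Rightarrow> 'a set \<Rightarrow> nat \<Rightarrow> real" where
  "max_information_gain K v X T =
     (SUP xs\<in>{xs. length xs = T \<and> set xs \<subseteq> X}. information_gain K v xs)"

end

theory Submission
  imports Defs "HOL-Real_Asymp.Real_Asymp"
begin

text \<open>
  Split the Mercer series of \<open>K\<close> at degree \<open>M\<close>. Adding one feature \<open>u\<close> to a matrix \<open>P \<ge> 1\<close> multiplies
  its determinant by \<open>1 + u\<^sup>T P\<^sup>-\<^sup>1 u \<le> 1 + \<bar>u\<bar>\<^sup>2\<close>. The features of degree below \<open>M\<close> are \<open>O(M\<^sup>d\<^sup>-\<^sup>1)\<close> in number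
  and contribute a factor \<open>1 + O(T)\<close> each; for those of higher degree \<open>1 + t \<le> exp t\<close> leaves \<open>exp\<close> of
  the trace of the tail. The pointwise bound \<open>\<Sum>\<^sub>j Y\<^sub>j\<^sub>k(x)\<^sup>2 \<le> N(d, k)\<close>, from rotation invariance, and
  \<open>\<mu>\<^sub>k N(d, k) = O(k\<^sup>-\<^sup>2)\<close> make that trace \<open>O(T / M)\<close>. Hence
  \<open>\<gamma>\<^sub>T = O(M\<^sup>d\<^sup>-\<^sup>1 ln (1 + T / \<sigma>\<^sup>2) + T / M)\<close>, and the two terms balance for
  \<open>M\<^sup>d \<approx> C T / ln (1 + T / \<sigma>\<^sup>2)\<close>.
\<close>

subsection \<open>Determinants of Gram matrices\<close>

text \<open>The block matrix with rows \<open>(1, -u)\<close> and \<open>(w, 1)\<close> factors into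
  block triangular matrices in two ways. One leaves the n by n Schur complement
  \<open>1 + w u\<^sup>T\<close>, the other the 1 by 1 Schur complement
  \<open>1 + u \<bullet> w\<close>; every other diagonal block is an identity.\<close>

lemma det_one_plus_rank_one:
  fixes u w :: "nat \<Rightarrow> real"
  shows "Determinant.det (Matrix.mat n n (\<lambda>(i, j). (if i = j then 1 else 0) + w i * u j))
     = 1 + (\<Sum>i<n. u i * w i)"
proof -
  let ?U = "Matrix.mat 1 n (\<lambda>(i, j). - u j)" and ?W = "Matrix.mat n 1 (\<lambda>(i, j). w i)"
  let ?s = "\<Sum>i<n. u i * w i"
  let ?R = "Matrix.mat n n (\<lambda>(i, j). (if i = j then 1 else 0) + w i * u j)"
  let ?S = "Matrix.mat 1 1 (\<lambda>_. 1 + ?s)"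
  have "four_block_mat (1\<^sub>m 1) (0\<^sub>m 1 n) ?W (1\<^sub>m n) * four_block_mat (1\<^sub>m 1) ?U (0\<^sub>m n 1) ?R
      = four_block_mat (1\<^sub>m 1) ?U ?W (1\<^sub>m n)"
    by (subst mult_four_block_mat[of _ 1 1 _ n _ n _ _ 1 _ n])
       (auto intro!: cong_four_block_mat eq_matI simp: scalar_prod_def)
  also have "\<dots> = four_block_mat (1\<^sub>m 1) ?U (0\<^sub>m n 1) (1\<^sub>m n) * four_block_mat ?S (0\<^sub>m 1 n) ?W (1\<^sub>m n)"
    by (subst mult_four_block_mat[of _ 1 1 _ n _ n _ _ 1 _ n])
       (auto intro!: cong_four_block_mat eq_matI
          simp: scalar_prod_def sum_negf lessThan_atLeast0)
  finally have "Determinant.det (four_block_mat (1\<^sub>m 1) (0\<^sub>m 1 n) ?W (1\<^sub>m n) * four_block_mat (1\<^sub>m 1) ?U (0\<^sub>m n 1) ?R)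
     = Determinant.det (four_block_mat (1\<^sub>m 1) ?U (0\<^sub>m n 1) (1\<^sub>m n) * four_block_mat ?S (0\<^sub>m 1 n) ?W (1\<^sub>m n))"
    by simp
  then show ?thesis
    by (subst (asm) (1 2) det_mult[where n="1+n"])
       (auto simp: det_four_block_mat_upper_right_zero[where n=1 and m=n]
          det_four_block_mat_lower_left_zero[where n=1 and m=n] det_single)
qed

text \<open>Here \<open>w\<close> stands for \<open>P\<^sup>-\<^sup>1 v\<close>, so the updated
  matrix is \<open>P (1 + w u\<^sup>T)\<close>. Giving \<open>w\<close> as a solution of a linear
  system keeps matrix inverses out of the argument.\<close>

lemma det_rank_one_update:
  fixes P :: "real Matrix.mat"
  assumes P: "P \<in> carrier_mat n n" and w: "\<And>s. s < n \<Longrightarrow> (\<Sum>t<n. P $$ (s, t) * w t) = v s"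
  shows "Determinant.det (Matrix.mat n n (\<lambda>(s, t). P $$ (s, t) + v s * u t))
    = Determinant.det P * (1 + (\<Sum>t<n. u t * w t))"
proof -
  have "Matrix.mat n n (\<lambda>(s, t). P $$ (s, t) + v s * u t)
      = P * Matrix.mat n n (\<lambda>(i, j). (if i = j then 1 else 0) + w i * u j)"
  proof (rule eq_matI)
    fix s t assume "s < dim_row (P * Matrix.mat n n (\<lambda>(i, j). (if i = j then 1 else 0) + w i * u j))"
      "t < dim_col (P * Matrix.mat n n (\<lambda>(i, j). (if i = j then 1 else 0) + w i * u j))"
    then have st: "s < n" "t < n" using P by auto
    have "(P * Matrix.mat n n (\<lambda>(i, j). (if i = j then 1 else 0) + w i * u j)) $$ (s, t)
       = (\<Sum>i<n. P $$ (s, i) * ((if i = t then 1 else 0) + w i * u t))"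
      using P st by (simp add: scalar_prod_def lessThan_atLeast0)
    also have "\<dots> = (\<Sum>i<n. if i = t then P $$ (s, i) else 0) + (\<Sum>i<n. P $$ (s, i) * w i) * u t"
      unfolding sum_distrib_right sum.distrib[symmetric] by (intro sum.cong) (auto simp: algebra_simps)
    also have "\<dots> = P $$ (s, t) + v s * u t"
      using st w by simp
    finally show "Matrix.mat n n (\<lambda>(s, t). P $$ (s, t) + v s * u t) $$ (s, t)
       = (P * Matrix.mat n n (\<lambda>(i, j). (if i = j then 1 else 0) + w i * u j)) $$ (s, t)"
      using st by simp
  qed (use P in auto)
  then show ?thesis
    using P by (simp add: det_mult[where n=n] det_one_plus_rank_one)
qed

text \<open>Cramer's rule: the adjugate applied to the right-hand side, divided by the
  determinant.\<close>

lemma det_nonzero_imp_solvable: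
  fixes P :: "'a::field Matrix.mat"
  assumes P: "P \<in> carrier_mat n n" and "Determinant.det P \<noteq> 0"
  obtains w where "\<And>s. s < n \<Longrightarrow> (\<Sum>t<n. P $$ (s, t) * w t) = u s"
proof -
  let ?x = "adj_mat P *\<^sub>v Matrix.vec n u"
  have A: "adj_mat P \<in> carrier_mat n n" "P * adj_mat P = Determinant.det P \<cdot>\<^sub>m 1\<^sub>m n"
    using adj_mat[OF P] by auto
  have "P *\<^sub>v ?x = Determinant.det P \<cdot>\<^sub>v Matrix.vec n u"
    using P A by (subst assoc_mult_mat_vec[symmetric, of _ n n _ n]) (auto simp: scalar_prod_def mult_delta_left mult_delta_right intro!: eq_vecI)
  then have *: "(P *\<^sub>v ?x) $ s = Determinant.det P * u s" if "s < n" for s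
    using that by simp
  have "(\<Sum>t<n. P $$ (s, t) * (?x $ t / Determinant.det P)) = u s" if "s < n" for s
  proof -
    have "(\<Sum>t<n. P $$ (s, t) * ?x $ t) = (P *\<^sub>v ?x) $ s"
      using that P A(1) by (simp add: scalar_prod_def lessThan_atLeast0)
    then have "(\<Sum>t<n. P $$ (s, t) * ?x $ t) = Determinant.det P * u s"
      using * that by simp
    then show ?thesis
      using assms(2) by (simp add: sum_divide_distrib[symmetric])
  qed
  then show ?thesis by (rule that)
qed

text \<open>Hypothesis \<open>ge\<close> says \<open>P \<ge> 1\<close> as a quadratic form. For
  \<open>w = P\<^sup>-\<^sup>1 u\<close> and \<open>a = u \<bullet> w\<close> it gives
  \<open>|w|\<^sup>2 \<le> a\<close>, and Cauchy-Schwarz then gives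
  \<open>a\<^sup>2 \<le> |u|\<^sup>2 a\<close>. Hence
  \<open>0 \<le> a \<le> |u|\<^sup>2\<close>.\<close>

lemma det_rank_one_update_bounds:
  fixes P :: "real Matrix.mat" and u :: "nat \<Rightarrow> real"
  assumes P: "P \<in> carrier_mat n n"
    and ge: "\<And>x. (\<Sum>s<n. (x s)\<^sup>2) \<le> (\<Sum>s<n. x s * (\<Sum>t<n. P $$ (s, t) * x t))"
    and pos: "1 \<le> Determinant.det P"
  defines "Q \<equiv> Matrix.mat n n (\<lambda>(s, t). P $$ (s, t) + u s * u t)"
  shows "1 \<le> Determinant.det Q" "Determinant.det Q \<le> Determinant.det P * (1 + (\<Sum>t<n. (u t)\<^sup>2))"
proof -
  obtain w where w: "\<And>s. s < n \<Longrightarrow> (\<Sum>t<n. P $$ (s, t) * w t) = u s"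
    using det_nonzero_imp_solvable[OF P] pos by (metis not_one_le_zero)
  have Q: "Determinant.det Q = Determinant.det P * (1 + (\<Sum>t<n. u t * w t))"
    unfolding Q_def by (rule det_rank_one_update[OF P w])
  define a where "a = (\<Sum>t<n. u t * w t)"
  have wa: "(\<Sum>t<n. (w t)\<^sup>2) \<le> a"
    using ge[of w] w by (simp add: a_def mult.commute)
  then have "0 \<le> a"
    by (meson order_trans sum_nonneg zero_le_power2)
  moreover have "a \<le> (\<Sum>t<n. (u t)\<^sup>2)"
  proof (cases "a = 0")
    case False
    have "a * a \<le> (\<Sum>t<n. (u t)\<^sup>2) * (\<Sum>t<n. (w t)\<^sup>2)"
      unfolding a_def power2_eq_square[symmetric] by (rule Cauchy_Schwarz_ineq_sum)
    also have "\<dots> \<le> (\<Sum>t<n. (u t)\<^sup>2) * a"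
      using wa by (intro mult_left_mono sum_nonneg) auto
    finally show ?thesis
      using False \<open>0 \<le> a\<close> by simp
  qed (simp add: sum_nonneg)
  ultimately show "1 \<le> Determinant.det Q" "Determinant.det Q \<le> Determinant.det P * (1 + (\<Sum>t<n. (u t)\<^sup>2))"
    using pos mult_mono[of 1 "Determinant.det P" 1 "1 + a"] unfolding Q a_def[symmetric]
    by (auto intro!: mult_left_mono)
qed

text \<open>Features are added one at a time, each as a rank-one update. The lower bound keeps the
  induction going and later makes the information gain nonnegative.\<close>

lemma det_one_plus_gram_bounds:
  fixes u :: "'i \<Rightarrow> nat \<Rightarrow> real" and n :: nat
  assumes "finite I"
  defines "G \<equiv> \<lambda>I. Matrix.mat n n (\<lambda>(s, t). (if s = t then 1 else 0) + (\<Sum>i\<in>I. u i s * u i t))"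
  shows "1 \<le> Determinant.det (G I) \<and> Determinant.det (G I) \<le> (\<Prod>i\<in>I. 1 + (\<Sum>t<n. (u i t)\<^sup>2))"
  using \<open>finite I\<close>
proof (induction I rule: finite_induct)
  case empty
  have "G {} = 1\<^sub>m n" by (auto simp: G_def)
  then show ?case by simp
next
  case (insert a I)
  have G: "G I \<in> carrier_mat n n" by (simp add: G_def)
  have *: "G (insert a I) = Matrix.mat n n (\<lambda>(s, t). G I $$ (s, t) + u a s * u a t)"
    using insert by (intro eq_matI) (auto simp: G_def)
  \<comment> \<open>The quadratic form of the Gram part is a sum of squares, so \<open>G I\<close>
    dominates the identity.\<close>
  have ge: "(\<Sum>s<n. (x s)\<^sup>2) \<le> (\<Sum>s<n. x s * (\<Sum>t<n. G I $$ (s, t) * x t))" for x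
  proof -
    have "(\<Sum>s<n. x s * (\<Sum>t<n. G I $$ (s, t) * x t))
      = (\<Sum>s<n. x s * (\<Sum>t<n. (if s = t then x t else 0) + (\<Sum>i\<in>I. u i s * u i t * x t)))"
      by (intro sum.cong arg_cong2[of _ _ _ _ "(*)"]) (auto simp: G_def sum_distrib_right sum_distrib_left algebra_simps)
    also have "\<dots> = (\<Sum>s<n. (x s)\<^sup>2) + (\<Sum>s<n. \<Sum>t<n. \<Sum>i\<in>I. (u i s * x s) * (u i t * x t))"
      by (simp add: sum.distrib algebra_simps power2_eq_square sum_distrib_left)
    also have "(\<Sum>s<n. \<Sum>t<n. \<Sum>i\<in>I. (u i s * x s) * (u i t * x t))
       = (\<Sum>s<n. \<Sum>i\<in>I. \<Sum>t<n. (u i s * x s) * (u i t * x t))"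
      by (intro sum.cong refl sum.swap)
    also have "\<dots> = (\<Sum>i\<in>I. \<Sum>s<n. \<Sum>t<n. (u i s * x s) * (u i t * x t))"
      by (rule sum.swap)
    also have "\<dots> = (\<Sum>i\<in>I. (\<Sum>s<n. u i s * x s)\<^sup>2)"
      by (simp add: power2_eq_square sum_product)
    finally show ?thesis
      by (simp add: sum_nonneg)
  qed
  have "1 \<le> Determinant.det (G (insert a I))"
       "Determinant.det (G (insert a I)) \<le> Determinant.det (G I) * (1 + (\<Sum>t<n. (u a t)\<^sup>2))"
    unfolding * using det_rank_one_update_bounds[OF G ge] insert.IH by blast+
  moreover have "Determinant.det (G I) * (1 + (\<Sum>t<n. (u a t)\<^sup>2))
      \<le> (\<Prod>i\<in>I. 1 + (\<Sum>t<n. (u i t)\<^sup>2)) * (1 + (\<Sum>t<n. (u a t)\<^sup>2))"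
    using insert.IH by (intro mult_right_mono add_nonneg_nonneg sum_nonneg) auto
  ultimately show ?case
    using insert.hyps by (auto simp: mult.commute)
qed

subsection \<open>Spherical harmonics under rotations\<close>

text \<open>The partial derivatives are again polynomials, so the lemma can be applied to them a
  second time to reach second derivatives.\<close>

lemma has_derivative_real_polynomial_function:
  fixes p :: "real ^ 'd::finite \<Rightarrow> real"
  assumes "real_polynomial_function p"
  shows "\<exists>g. (\<forall>a. real_polynomial_function (g a)) \<and>
    (\<forall>x. (p has_derivative (\<lambda>h. \<Sum>a\<in>UNIV. g a x * vec_nth h a)) (at x))"
  using assms
proof induction
  case (linear f)
  have eq: "f h = (\<Sum>a\<in>UNIV. f (axis a 1) * vec_nth h a)" for h
  proof -
    have "h = (\<Sum>a\<in>UNIV. vec_nth h a *\<^sub>R axis a 1)"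
      by (simp add: Finite_Cartesian_Product.vec_eq_iff axis_def if_distrib cong: if_cong)
    then have "f h = f (\<Sum>a\<in>UNIV. vec_nth h a *\<^sub>R axis a 1)" by simp
    also have "\<dots> = (\<Sum>a\<in>UNIV. f (axis a 1) * vec_nth h a)"
      using linear by (simp add: bounded_linear.linear linear_sum linear_cmul mult.commute)
    finally show ?thesis .
  qed
  have "(f has_derivative (\<lambda>h. \<Sum>a\<in>UNIV. f (axis a 1) * vec_nth h a)) (at x)" for x
    using bounded_linear_imp_has_derivative[OF linear, of "at x"]
    by (subst (asm) (2) eq[abs_def])
  then show ?case
    by (intro exI[of _ "\<lambda>a x. f (axis a 1)"]) auto
next
  case (const c)
  then show ?case
    by (intro exI[of _ "\<lambda>a x. 0"]) auto
next
  case (add f g)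
  from add.IH(1) obtain f' where f': "\<And>a. real_polynomial_function (f' a)"
    "\<And>x. (f has_derivative (\<lambda>h. \<Sum>a\<in>UNIV. f' a x * vec_nth h a)) (at x)"
    by blast
  from add.IH(2) obtain g' where g': "\<And>a. real_polynomial_function (g' a)"
    "\<And>x. (g has_derivative (\<lambda>h. \<Sum>a\<in>UNIV. g' a x * vec_nth h a)) (at x)"
    by blast
  show ?case
  proof (intro exI[of _ "\<lambda>a x. f' a x + g' a x"] conjI allI)
    show "((\<lambda>x. f x + g x) has_derivative (\<lambda>h. \<Sum>a\<in>UNIV. (f' a x + g' a x) * vec_nth h a)) (at x)" for x
      using has_derivative_add[OF f'(2) g'(2)] by (simp add: distrib_right sum.distrib)
  qed (use f' g' in auto)
next
  case (mult f g)
  from mult.IH(1) obtain f' where f': "\<And>a. real_polynomial_function (f' a)"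
    "\<And>x. (f has_derivative (\<lambda>h. \<Sum>a\<in>UNIV. f' a x * vec_nth h a)) (at x)"
    by blast
  from mult.IH(2) obtain g' where g': "\<And>a. real_polynomial_function (g' a)"
    "\<And>x. (g has_derivative (\<lambda>h. \<Sum>a\<in>UNIV. g' a x * vec_nth h a)) (at x)"
    by blast
  show ?case
  proof (intro exI[of _ "\<lambda>a x. f x * g' a x + f' a x * g x"] conjI allI)
    show "((\<lambda>x. f x * g x) has_derivative
        (\<lambda>h. \<Sum>a\<in>UNIV. (f x * g' a x + f' a x * g x) * vec_nth h a)) (at x)" for x
      using has_derivative_mult[OF f'(2) g'(2)]
      by (simp add: algebra_simps sum.distrib sum_distrib_left)
  qed (intro real_polynomial_function.intros(3,4) f' g' mult.hyps)
qed

text \<open>\<open>H\<close> is the Hessian. The point is that one \<open>H\<close> serves all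
  directions \<open>v\<close>, which turns the Laplacian into a trace.\<close>

lemma deriv_twice_real_polynomial_along_line:
  fixes p :: "real ^ 'd::finite \<Rightarrow> real"
  assumes "real_polynomial_function p"
  obtains H where "\<And>x v. (deriv ^^ 2) (\<lambda>t. p (x + t *\<^sub>R v)) 0
    = (\<Sum>a\<in>UNIV. \<Sum>b\<in>UNIV. H a b x * (vec_nth v a * vec_nth v b))"
proof -
  have line: "((\<lambda>t. q (x + t *\<^sub>R v)) has_real_derivative
      (\<Sum>a\<in>UNIV. g a (x + t *\<^sub>R v) * vec_nth v a)) (at t)"
    if "\<And>x. (q has_derivative (\<lambda>h. \<Sum>a\<in>UNIV. g a x * vec_nth h a)) (at x)"
    for q :: "real ^ 'd \<Rightarrow> real" and g x v t
  proof -
    have "((\<lambda>t. x + t *\<^sub>R v) has_derivative (\<lambda>h. h *\<^sub>R v)) (at t)"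
      by (auto intro!: derivative_eq_intros)
    from has_derivative_compose[OF this that] show ?thesis
      unfolding has_field_derivative_def
      by (rule has_derivative_eq_rhs) (auto simp: sum_distrib_left sum_distrib_right mult_ac)
  qed
  obtain g where g: "\<And>a. real_polynomial_function (g a)"
    "\<And>x. (p has_derivative (\<lambda>h. \<Sum>a\<in>UNIV. g a x * vec_nth h a)) (at x)"
    using has_derivative_real_polynomial_function[OF assms] by blast
  have "\<forall>a. \<exists>h. \<forall>x. (g a has_derivative (\<lambda>v. \<Sum>b\<in>UNIV. h b x * vec_nth v b)) (at x)"
    using has_derivative_real_polynomial_function[OF g(1)] by blast
  from choice[OF this] obtain H where
    H: "\<And>a x. (g a has_derivative (\<lambda>v. \<Sum>b\<in>UNIV. H a b x * vec_nth v b)) (at x)"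
    by blast
  have "(deriv ^^ 2) (\<lambda>t. p (x + t *\<^sub>R v)) 0
    = (\<Sum>a\<in>UNIV. \<Sum>b\<in>UNIV. H a b x * (vec_nth v a * vec_nth v b))" for x v
  proof -
    have 1: "deriv (\<lambda>t. p (x + t *\<^sub>R v)) = (\<lambda>t. \<Sum>a\<in>UNIV. g a (x + t *\<^sub>R v) * vec_nth v a)"
      by (rule ext, rule DERIV_imp_deriv, rule line, rule g)
    have "((\<lambda>t. \<Sum>a\<in>UNIV. g a (x + t *\<^sub>R v) * vec_nth v a) has_real_derivative
       (\<Sum>a\<in>UNIV. (\<Sum>b\<in>UNIV. H a b (x + 0 *\<^sub>R v) * vec_nth v b) * vec_nth v a)) (at 0)"
      by (intro DERIV_sum DERIV_cmult_right line H)
    then show ?thesis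
      by (simp add: numeral_2_eq_2 1 DERIV_imp_deriv sum_distrib_right sum_distrib_left mult_ac)
  qed
  then show ?thesis by (rule that)
qed

text \<open>The vectors \<open>R (axis i 1)\<close> are the columns of the matrix of
  \<open>R\<close>, so this is the identity \<open>R R\<^sup>T = 1\<close>, read entrywise.\<close>

lemma orthogonal_transformation_sum_component_mult:
  fixes R :: "real ^ 'd::finite \<Rightarrow> real ^ 'd"
  assumes "orthogonal_transformation R"
  shows "(\<Sum>i\<in>UNIV. vec_nth (R (axis i 1)) a * vec_nth (R (axis i 1)) b) = (if a = b then 1 else 0)"
proof -
  have "matrix R ** Finite_Cartesian_Product.transpose (matrix R) = Finite_Cartesian_Product.mat 1"
    using assms orthogonal_transformation_matrix orthogonal_matrix_def by blast
  then have "vec_nth (vec_nth (matrix R ** Finite_Cartesian_Product.transpose (matrix R)) a) b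
     = vec_nth (vec_nth (Finite_Cartesian_Product.mat 1) a) b" by simp
  then show ?thesis
    by (simp add: matrix_def matrix_matrix_mult_def Finite_Cartesian_Product.transpose_def Finite_Cartesian_Product.mat_def)
qed

text \<open>By the chain rule along lines, the left side is the trace of the Hessian of
  \<open>p\<close> at \<open>R x\<close>, taken in the rotated frame
  \<open>R (axis i 1)\<close>.\<close>

lemma laplacian_compose_orthogonal:
  fixes R :: "real ^ 'd::finite \<Rightarrow> real ^ 'd"
  assumes p: "real_polynomial_function p" and R: "orthogonal_transformation R"
  shows "laplacian (p \<circ> R) x = laplacian p (R x)"
proof -
  obtain H where H: "\<And>x v. (deriv ^^ 2) (\<lambda>t. p (x + t *\<^sub>R v)) 0
    = (\<Sum>a\<in>UNIV. \<Sum>b\<in>UNIV. H a b x * (vec_nth v a * vec_nth v b))"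
    using deriv_twice_real_polynomial_along_line[OF p] by blast
  \<comment> \<open>The trace is the same in every orthonormal frame. The two frames compared at the
    end come from \<open>S = R\<close> and from the identity.\<close>
  have trace: "(\<Sum>i\<in>UNIV. (deriv ^^ 2) (\<lambda>t. p (y + t *\<^sub>R S (axis i 1))) 0) = (\<Sum>a\<in>UNIV. H a a y)"
    if "orthogonal_transformation S" for S :: "real ^ 'd \<Rightarrow> real ^ 'd" and y
  proof -
    have "(\<Sum>i\<in>UNIV. (deriv ^^ 2) (\<lambda>t. p (y + t *\<^sub>R S (axis i 1))) 0)
      = (\<Sum>i\<in>UNIV. \<Sum>a\<in>UNIV. \<Sum>b\<in>UNIV. H a b y * (vec_nth (S (axis i 1)) a * vec_nth (S (axis i 1)) b))"
      by (simp add: H)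
    also have "\<dots> = (\<Sum>a\<in>UNIV. \<Sum>i\<in>UNIV. \<Sum>b\<in>UNIV. H a b y * (vec_nth (S (axis i 1)) a * vec_nth (S (axis i 1)) b))"
      by (rule sum.swap)
    also have "\<dots> = (\<Sum>a\<in>UNIV. \<Sum>b\<in>UNIV. \<Sum>i\<in>UNIV. H a b y * (vec_nth (S (axis i 1)) a * vec_nth (S (axis i 1)) b))"
      by (intro sum.cong refl sum.swap)
    also have "\<dots> = (\<Sum>a\<in>UNIV. H a a y)"
      by (simp add: sum_distrib_left[symmetric] orthogonal_transformation_sum_component_mult[OF that] mult_delta_right)
    finally show ?thesis .
  qed
  have "linear R" using R by (rule orthogonal_transformation_linear)
  then show ?thesis
    using trace[OF R, of "R x"] trace[OF orthogonal_transformation_id, of "R x"]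
    by (simp add: laplacian_def linear_add linear_cmul)
qed

text \<open>This lets a rotated basis harmonic be expanded again in the basis of the same
  degree.\<close>

lemma harmonic_polys_compose_orthogonal:
  fixes R :: "real ^ 'd::finite \<Rightarrow> real ^ 'd"
  assumes "p \<in> harmonic_polys k" and R: "orthogonal_transformation R"
  shows "p \<circ> R \<in> harmonic_polys k"
proof -
  have lin: "linear R" using R by (rule orthogonal_transformation_linear)
  have p: "real_polynomial_function p" using assms by (simp add: harmonic_polys_def)
  have "real_polynomial_function (p \<circ> R)"
    by (rule real_polynomial_function_compose[OF polynomial_function_bounded_linear p])
       (use lin linear_conv_bounded_linear in auto)
  then show ?thesis
    using assms(1) lin laplacian_compose_orthogonal[OF p R]
    by (auto simp: harmonic_polys_def linear_cmul)
qed

section \<open>Rotation invariance of Lebesgue measure and of the uniform measure on the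
  sphere\<close>

lemma borel_measurable_orthogonal_transformation:
  fixes R :: "'a::euclidean_space \<Rightarrow> 'a"
  assumes "orthogonal_transformation R"
  shows "R \<in> borel_measurable borel"
  using assms by (intro borel_measurable_continuous_onI linear_continuous_on)
    (auto simp: linear_conv_bounded_linear[symmetric] orthogonal_transformation_linear)

lemma emeasure_unit_ball:
  "emeasure lborel (ball (c::'a::euclidean_space) 1) \<noteq> 0"
  "emeasure lborel (ball (c::'a) 1) \<noteq> \<infinity>"
  using emeasure_bounded_finite[OF bounded_ball, of c 1] content_ball_pos[of 1 c]
  by (auto simp: Sigma_Algebra.measure_def)

text \<open>
  The library's change of variables for linear maps needs a well-ordered index type. Instead, this is
  the uniqueness proof for Haar measure: by Tonelli and translation invariance,
  \<open>\<lambda>(R\<^sup>-\<^sup>1 A) \<lambda>(B) = \<lambda>(A) \<lambda>(B)\<close> for the unit ball \<open>B\<close>.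
\<close>

lemma distr_lborel_orthogonal:
  fixes R :: "'a::euclidean_space \<Rightarrow> 'a"
  assumes R: "orthogonal_transformation R"
  shows "distr lborel borel R = lborel"
proof (rule measure_eqI)
  have meas [measurable]: "R \<in> borel_measurable borel"
    by (rule borel_measurable_orthogonal_transformation[OF R])
  have linR: "linear R" by (rule orthogonal_transformation_linear[OF R])
  have RR: "R (Hilbert_Choice.inv R y) = y" for y
    using R by (simp add: orthogonal_transformation_surj surj_f_inv_f)
  have shift: "(\<integral>\<^sup>+x. f (c + x) \<partial>lborel) = (\<integral>\<^sup>+x. f x \<partial>lborel)"
    if [measurable]: "f \<in> borel_measurable borel" for f and c :: 'a
  proof -
    have "(\<integral>\<^sup>+x. f x \<partial>lborel) = (\<integral>\<^sup>+x. f x \<partial>distr lborel borel ((+) c))"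
      by (simp only: lborel_distr_plus)
    also have "\<dots> = (\<integral>\<^sup>+x. f (c + x) \<partial>lborel)"
      by (subst nn_integral_distr) auto
    finally show ?thesis ..
  qed
  fix A assume "A \<in> sets (distr lborel borel R)"
  then have A [measurable]: "A \<in> sets borel" by simp
  let ?B = "ball (0 :: 'a) 1"
  let ?I = "indicator :: 'a set \<Rightarrow> 'a \<Rightarrow> ennreal"
  have B [measurable]: "?B \<in> sets borel" by simp
  have RA: "R -` A \<in> sets borel"
    using measurable_sets[OF meas A] by simp
  \<comment> \<open>Since \<open>R\<close> is an onto isometry, the points \<open>x\<close> with
    \<open>R x\<close> at distance less than 1 from \<open>y\<close> form the unit ball around the
    preimage of \<open>y\<close>.\<close>
  have ball_shift: "(\<integral>\<^sup>+x. ?I ?B (- R x + y) \<partial>lborel) = emeasure lborel ?B" for y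
  proof -
    have "?I ?B (- R x + y) = ?I ?B (- Hilbert_Choice.inv R y + x)" for x
    proof -
      have "- R x + y = - R (- Hilbert_Choice.inv R y + x)"
        using linR by (simp add: linear_add linear_neg linear_diff RR)
      then have "norm (- R x + y) = norm (- Hilbert_Choice.inv R y + x)"
        using R by (simp only: norm_minus_cancel orthogonal_transformation_norm)
      then show ?thesis
        by (simp add: indicator_def)
    qed
    then show ?thesis
      using shift[of "?I ?B" "- Hilbert_Choice.inv R y"]
      by (simp add: borel_measurable_indicator)
  qed
  have "emeasure lborel (R -` A) * emeasure lborel ?B
      = (\<integral>\<^sup>+y. (\<integral>\<^sup>+x. ?I A (R x) \<partial>lborel) * ?I ?B y \<partial>lborel)"
    using RA by (simp add: nn_integral_cmult_indicator indicator_vimage[symmetric])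
  \<comment> \<open>Translating \<open>x\<close> by the preimage of \<open>y\<close> leaves the
    inner integral unchanged and brings \<open>y\<close> into the argument of the indicator of
    \<open>A\<close>.\<close>
  also have "\<dots> = (\<integral>\<^sup>+y. (\<integral>\<^sup>+x. ?I A (R (Hilbert_Choice.inv R y + x)) \<partial>lborel) * ?I ?B y \<partial>lborel)"
    by (simp add: shift[of "\<lambda>x. ?I A (R x)"])
  also have "\<dots> = (\<integral>\<^sup>+y. \<integral>\<^sup>+x. ?I A (R x + y) * ?I ?B y \<partial>lborel \<partial>lborel)"
    using linR by (simp add: linear_add RR nn_integral_multc add.commute)
  also have "\<dots> = (\<integral>\<^sup>+x. \<integral>\<^sup>+y. ?I A (R x + y) * ?I ?B y \<partial>lborel \<partial>lborel)"
    by (rule lborel_pair.Fubini') measurable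
  \<comment> \<open>With the integrals swapped, translating \<open>y\<close> by \<open>R x\<close>
    moves the dependence on \<open>x\<close> from \<open>A\<close> to the ball.\<close>
  also have "\<dots> = (\<integral>\<^sup>+x. \<integral>\<^sup>+y. ?I A y * ?I ?B (- R x + y) \<partial>lborel \<partial>lborel)"
  proof (rule nn_integral_cong)
    fix x
    show "(\<integral>\<^sup>+y. ?I A (R x + y) * ?I ?B y \<partial>lborel) = (\<integral>\<^sup>+y. ?I A y * ?I ?B (- R x + y) \<partial>lborel)"
      using shift[of "\<lambda>y. ?I A y * ?I ?B (- R x + y)" "R x"] by simp
  qed
  also have "\<dots> = (\<integral>\<^sup>+y. \<integral>\<^sup>+x. ?I A y * ?I ?B (- R x + y) \<partial>lborel \<partial>lborel)"
    by (rule lborel_pair.Fubini') measurable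
  also have "\<dots> = (\<integral>\<^sup>+y. ?I A y * (\<integral>\<^sup>+x. ?I ?B (- R x + y) \<partial>lborel) \<partial>lborel)"
    by (intro nn_integral_cong nn_integral_cmult) measurable
  also have "\<dots> = emeasure lborel A * emeasure lborel ?B"
    unfolding ball_shift by (simp add: nn_integral_multc)
  finally have "emeasure lborel (R -` A) = emeasure lborel A"
    using emeasure_unit_ball[of "0 :: 'a"] by (simp add: mult.commute[of _ "emeasure lborel ?B"] ennreal_mult_cancel_left)
  then show "emeasure (distr lborel borel R) A = emeasure lborel A"
    by (simp add: emeasure_distr)
qed simp

lemma borel_measurable_sgn_vec [measurable]: "(sgn :: 'a::euclidean_space \<Rightarrow> 'a) \<in> borel_measurable borel"
  unfolding sgn_div_norm[abs_def] by measurable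

lemma prob_space_uniform_sphere: "prob_space (uniform_sphere :: (real ^ 'd::finite) measure)"
  unfolding uniform_sphere_def
  by (intro prob_space.prob_space_distr prob_space_uniform_measure emeasure_unit_ball) simp

lemma sets_uniform_sphere [measurable_cong, simp]: "sets uniform_sphere = sets borel"
  by (simp add: uniform_sphere_def)

text \<open>The only exception is the origin, where \<open>sgn\<close> is \<open>0\<close>; it is a
  Lebesgue null set.\<close>

lemma AE_uniform_sphere: "AE x in (uniform_sphere :: (real ^ 'd::finite) measure). norm x = 1"
  unfolding uniform_sphere_def
proof (subst AE_distr_iff)
  have "AE x in lborel. x \<noteq> (0 :: real ^ 'd)"
    by (rule AE_lborel_singleton)
  then have "AE x in (lborel :: (real ^ 'd) measure). x \<in> ball 0 1 \<longrightarrow> norm (sgn x) = 1"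
    by eventually_elim (auto simp: norm_sgn)
  then show "AE x in uniform_measure lborel (ball (0 :: real ^ 'd) 1). norm (sgn x) = 1"
    by (intro AE_uniform_measureI) auto
qed auto

text \<open>A rotation preserves Lebesgue measure and the unit ball and commutes with
  \<open>sgn\<close>, so invariance passes through both steps of the definition of
  \<open>uniform_sphere\<close>.\<close>

lemma distr_uniform_sphere_orthogonal:
  fixes R :: "real ^ 'd::finite \<Rightarrow> real ^ 'd"
  assumes R: "orthogonal_transformation R"
  shows "distr uniform_sphere borel R = uniform_sphere"
proof -
  let ?U = "uniform_measure lborel (ball (0 :: real ^ 'd) 1)"
  have meas [measurable]: "R \<in> borel_measurable borel"
    by (rule borel_measurable_orthogonal_transformation[OF R])
  have norm: "norm (R x) = norm x" for x
    using R by (simp add: orthogonal_transformation_norm)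
  have U: "distr ?U borel R = ?U"
  proof (rule measure_eqI)
    fix A assume "A \<in> sets (distr ?U borel R)"
    then have A [measurable]: "A \<in> sets borel" by simp
    have RA: "R -` A \<in> sets borel"
      using measurable_sets[OF meas A] by simp
    have "emeasure (distr ?U borel R) A = emeasure ?U (R -` A)"
      by (simp add: emeasure_distr)
    also have "\<dots> = emeasure lborel (ball 0 1 \<inter> R -` A) / emeasure lborel (ball (0 :: real ^ 'd) 1)"
      using RA by simp
    also have "ball 0 1 \<inter> R -` A = R -` (ball 0 1 \<inter> A)"
      by (auto simp: norm)
    also have "emeasure lborel (R -` (ball 0 1 \<inter> A)) = emeasure (distr lborel borel R) (ball 0 1 \<inter> A)"
      by (simp add: emeasure_distr)
    finally show "emeasure (distr ?U borel R) A = emeasure ?U A"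
      by (simp add: distr_lborel_orthogonal[OF R])
  qed simp
  have "R \<circ> sgn = sgn \<circ> R"
    using orthogonal_transformation_linear[OF R] by (auto simp: sgn_div_norm norm linear_cmul)
  then have "distr uniform_sphere borel R = distr (distr ?U borel R) borel sgn"
    by (simp add: uniform_sphere_def distr_distr)
  then show ?thesis
    by (simp only: U uniform_sphere_def)
qed

text \<open>A continuous function is bounded on the compact sphere, which carries all the mass, even
  if it is unbounded on the whole space.\<close>

lemma integrable_uniform_sphere_continuous:
  fixes f :: "real ^ 'd::finite \<Rightarrow> real"
  assumes f: "continuous_on UNIV f"
  shows "integrable uniform_sphere f"
proof -
  interpret prob_space "uniform_sphere :: (real ^ 'd) measure" by (rule prob_space_uniform_sphere)
  have "compact (f ` sphere 0 1)"
    using f by (intro compact_continuous_image) (auto intro: continuous_on_subset)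
  then have "bounded (f ` sphere 0 1)" by (rule compact_imp_bounded)
  then obtain B where "\<forall>y\<in>f ` sphere 0 1. norm y \<le> B"
    unfolding bounded_iff by blast
  then have B: "norm (f x) \<le> B" if "norm x = 1" for x
    using that by simp
  show ?thesis
  proof (rule integrable_const_bound)
    show "AE x in uniform_sphere. norm (f x) \<le> B"
      using AE_uniform_sphere by eventually_elim (rule B)
    show "f \<in> borel_measurable uniform_sphere"
      using f borel_measurable_continuous_onI by (simp cong: measurable_cong_sets)
  qed
qed

text \<open>The inequality half of the addition theorem. The sum \<open>Z\<close> has mean
  \<open>N(d, k)\<close> by orthonormality, and rotation invariance shows that its value at
  \<open>y\<close> is at most its value at any other point of the sphere, hence at most the
  mean.\<close>

lemma sum_spherical_harmonics_sq_le:
  fixes Y :: "nat \<Rightarrow> nat \<Rightarrow> real ^ 'd::finite \<Rightarrow> real"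
  assumes Y: "spherical_harmonics_basis Y" and y: "norm y = 1"
  shows "(\<Sum>j=1..num_harmonics CARD('d) k. (Y j k y)\<^sup>2) \<le> real (num_harmonics CARD('d) k)"
proof -
  interpret prob_space "uniform_sphere :: (real ^ 'd) measure" by (rule prob_space_uniform_sphere)
  let ?J = "{1..num_harmonics CARD('d) k}"
  define Z where "Z x = (\<Sum>j\<in>?J. (Y j k x)\<^sup>2)" for x
  have hp: "Y j k \<in> harmonic_polys k" if "j \<in> ?J" for j
    using Y that unfolding spherical_harmonics_basis_def by blast
  have orth: "(LINT x|uniform_sphere. Y i k x * Y j k x) = (if i = j then 1 else 0)"
    if "i \<in> ?J" "j \<in> ?J" for i j
    using Y that unfolding spherical_harmonics_basis_def by blast
  have span: "\<exists>c. \<forall>x. p x = (\<Sum>j\<in>?J. c j * Y j k x)" if "p \<in> harmonic_polys k" for p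
    using Y that unfolding spherical_harmonics_basis_def by blast
  have cont: "continuous_on UNIV (Y j k)" if "j \<in> ?J" for j
    using hp[OF that] by (auto simp: harmonic_polys_def real_polynomial_function_eq
        intro: continuous_on_polymonial_function)
  have int: "integrable uniform_sphere (\<lambda>x. Y i k x * Y j k x)" if "i \<in> ?J" "j \<in> ?J" for i j
    using that by (intro integrable_uniform_sphere_continuous continuous_on_mult cont)
  \<comment> \<open>Parseval's identity for the basis of degree \<open>k\<close>.\<close>
  have norm_sq: "(LINT x|uniform_sphere. (\<Sum>j\<in>?J. c j * Y j k x)\<^sup>2) = (\<Sum>j\<in>?J. (c j)\<^sup>2)" for c
  proof -
    have "(LINT x|uniform_sphere. (\<Sum>j\<in>?J. c j * Y j k x)\<^sup>2)
      = (LINT x|uniform_sphere. (\<Sum>i\<in>?J. \<Sum>j\<in>?J. (c i * c j) * (Y i k x * Y j k x)))"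
      by (simp add: power2_eq_square sum_product mult_ac)
    also have "\<dots> = (\<Sum>i\<in>?J. \<Sum>j\<in>?J. (c i * c j) * (LINT x|uniform_sphere. Y i k x * Y j k x))"
    proof (subst Bochner_Integration.integral_sum)
      show "(\<Sum>i\<in>?J. LINT x|uniform_sphere. (\<Sum>j\<in>?J. (c i * c j) * (Y i k x * Y j k x)))
        = (\<Sum>i\<in>?J. \<Sum>j\<in>?J. (c i * c j) * (LINT x|uniform_sphere. Y i k x * Y j k x))"
        using int by (intro sum.cong refl, subst Bochner_Integration.integral_sum) auto
    qed (use int in auto)
    also have "\<dots> = (\<Sum>i\<in>?J. \<Sum>j\<in>?J. if i = j then c i * c j else 0)"
      by (intro sum.cong refl) (simp add: orth)
    also have "\<dots> = (\<Sum>j\<in>?J. (c j)\<^sup>2)"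
      by (simp add: power2_eq_square)
    finally show ?thesis .
  qed
  \<comment> \<open>Rotate \<open>x\<close> to \<open>y\<close>. The function \<open>p\<close>, with
    coefficients \<open>Y j k y\<close>, satisfies \<open>p y = Z y\<close> and has squared norm
    \<open>Z y\<close>. Its rotation has the same norm and value \<open>Z y\<close> at
    \<open>x\<close>, so Cauchy-Schwarz on its coefficients \<open>c\<close> gives
    \<open>(Z y)\<^sup>2 \<le> Z y * Z x\<close>.\<close>
  have Z_le: "Z y \<le> Z x" if "norm x = 1" for x
  proof -
    obtain R where R: "orthogonal_transformation R" "R x = y"
      using orthogonal_transformation_exists_1[OF \<open>norm x = 1\<close> y] by blast
    have "\<forall>j\<in>?J. \<exists>c. \<forall>z. (Y j k \<circ> R) z = (\<Sum>i\<in>?J. c i * Y i k z)"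
      using span harmonic_polys_compose_orthogonal[OF hp R(1)] by blast
    from bchoice[OF this] obtain C where C: "\<And>j z. j \<in> ?J \<Longrightarrow> Y j k (R z) = (\<Sum>i\<in>?J. C j i * Y i k z)"
      by auto
    define p where "p z = (\<Sum>j\<in>?J. Y j k y * Y j k z)" for z
    define c where "c i = (\<Sum>j\<in>?J. Y j k y * C j i)" for i
    have pR: "p (R z) = (\<Sum>i\<in>?J. c i * Y i k z)" for z
    proof -
      have "p (R z) = (\<Sum>j\<in>?J. \<Sum>i\<in>?J. Y j k y * C j i * Y i k z)"
        by (simp add: p_def C sum_distrib_left mult_ac)
      also have "\<dots> = (\<Sum>i\<in>?J. \<Sum>j\<in>?J. Y j k y * C j i * Y i k z)"
        by (rule sum.swap)
      finally show ?thesis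
        by (simp add: c_def sum_distrib_right)
    qed
    have p_cont: "continuous_on UNIV p"
      unfolding p_def[abs_def] by (intro continuous_on_sum continuous_on_mult continuous_on_const cont)
    have R_meas: "R \<in> borel_measurable borel"
      by (rule borel_measurable_orthogonal_transformation[OF R(1)])
    have "(\<Sum>i\<in>?J. (c i)\<^sup>2) = (LINT z|uniform_sphere. (p (R z))\<^sup>2)"
      unfolding pR by (rule norm_sq[symmetric])
    also have "\<dots> = (LINT z|distr uniform_sphere borel R. (p z)\<^sup>2)"
      using R_meas borel_measurable_continuous_onI[OF p_cont]
      by (subst integral_distr) (auto cong: measurable_cong_sets)
    also have "\<dots> = Z y"
      unfolding distr_uniform_sphere_orthogonal[OF R(1)] p_def Z_def by (rule norm_sq)
    finally have c_sq: "(\<Sum>i\<in>?J. (c i)\<^sup>2) = Z y" .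
    have "Z y = (\<Sum>i\<in>?J. c i * Y i k x)"
      using pR[of x] by (simp add: R(2) p_def Z_def power2_eq_square)
    then have "(Z y)\<^sup>2 \<le> Z y * Z x"
      using Cauchy_Schwarz_ineq_sum[of c "\<lambda>i. Y i k x" ?J] unfolding c_sq Z_def[of x, symmetric] by simp
    moreover have "0 \<le> Z x" "0 \<le> Z y"
      by (simp_all add: Z_def sum_nonneg)
    ultimately show ?thesis
      by (cases "Z y = 0") (auto simp: power2_eq_square)
  qed
  have Z_cont: "continuous_on UNIV Z"
    unfolding Z_def[abs_def] by (intro continuous_on_sum continuous_on_power cont)
  have "Z y = (LINT x|(uniform_sphere :: (real ^ 'd) measure). Z y)"
    by (simp add: prob_space)
  also have "\<dots> \<le> (LINT x|uniform_sphere. Z x)"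
    using AE_uniform_sphere Z_le
    by (intro integral_mono_AE integrable_uniform_sphere_continuous Z_cont continuous_on_const) auto
  also have "\<dots> = (\<Sum>j\<in>?J. LINT x|uniform_sphere. Y j k x * Y j k x)"
    unfolding Z_def power2_eq_square using int by (intro Bochner_Integration.integral_sum) auto
  also have "\<dots> = real (num_harmonics CARD('d) k)"
    by (simp add: orth)
  finally show ?thesis
    by (simp add: Z_def)
qed

subsection \<open>Information gain\<close>

text \<open>By the Leibniz formula the determinant is a polynomial in the entries. This carries the
  bounds from truncated Mercer series over to the kernel itself.\<close>

lemma tendsto_det:
  fixes A :: "nat \<Rightarrow> nat \<Rightarrow> nat \<Rightarrow> real"
  assumes "\<And>i j. i < n \<Longrightarrow> j < n \<Longrightarrow> (\<lambda>m. A m i j) \<longlonglongrightarrow> B i j"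
  shows "(\<lambda>m. Determinant.det (Matrix.mat n n (\<lambda>(i, j). A m i j)))
    \<longlonglongrightarrow> Determinant.det (Matrix.mat n n (\<lambda>(i, j). B i j))"
proof -
  have perm: "p i < n" if "p permutes {0..<n}" "i < n" for p i
    using permutes_in_image[OF that(1), of i] that(2) by simp
  have det: "Determinant.det (Matrix.mat n n (\<lambda>(i, j). X i j))
    = (\<Sum>p | p permutes {0..<n}. signof p * (\<Prod>i = 0..<n. X i (p i)))" for X :: "nat \<Rightarrow> nat \<Rightarrow> real"
    by (subst det_def'[where n=n])
       (auto intro!: sum.cong prod.cong arg_cong2[of _ _ _ _ "(*)"] simp: perm)
  show ?thesis
    unfolding det by (intro tendsto_sum tendsto_mult tendsto_const tendsto_prod assms) (auto simp: perm)
qed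

text \<open>The Gram bounds need finitely many features, so they are applied to truncations and
  passed to the limit. At each point of the sphere, \<open>\<kappa>\<close> bounds the diagonal
  contribution of any single degree to the kernel and \<open>\<delta>\<close> that of the degrees
  from \<open>M\<close> on, uniformly in the truncation.\<close>

lemma information_gain_bounds:
  fixes K :: "real ^ 'd::finite \<Rightarrow> real ^ 'd \<Rightarrow> real"
  assumes Y: "spherical_harmonics_basis Y" and K: "mercer_decomposition K \<mu> Y"
    and v: "0 < v" and xs: "set xs \<subseteq> sphere 0 1"
    and \<kappa>: "\<And>k. \<mu> k * real (num_harmonics CARD('d) k) \<le> \<kappa>"
    and \<delta>: "\<And>n. (\<Sum>k=M..<n. \<mu> k * real (num_harmonics CARD('d) k)) \<le> \<delta>"
  shows "0 \<le> information_gain K v xs"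
    and "information_gain K v xs \<le> 1 / 2 *
      (real (\<Sum>k<M. num_harmonics CARD('d) k) * ln (1 + real (length xs) * \<kappa> / v)
        + real (length xs) * \<delta> / v)"
proof -
  let ?T = "length xs" and ?N = "num_harmonics CARD('d)"
  have mu: "0 \<le> \<mu> k" for k
    using K by (simp add: mercer_decomposition_def)
  have norm: "norm (xs ! t) = 1" if "t < ?T" for t
    using xs that nth_mem by fastforce
  have sq0: "0 \<le> (\<Sum>t<?T. (f t)\<^sup>2)" for f :: "nat \<Rightarrow> real"
    by (intro sum_nonneg) auto
  have \<kappa>0: "0 \<le> \<kappa>"
    using \<kappa>[of 0] mu[of 0] by (meson mult_nonneg_nonneg of_nat_0_le_iff order_trans)
  \<comment> \<open>The feature of \<open>(k, j)\<close> at the sample points, scaled so that the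
    Gram matrices of the truncations converge to the kernel matrix divided by
    \<open>v\<close>.\<close>
  define u where "u = (\<lambda>(k, j) t. sqrt (\<mu> k / v) * Y j k (xs ! t))"
  define I where "I n = Sigma {..<n} (\<lambda>k. {1..?N k})" for n
  define G where "G n = Matrix.mat ?T ?T (\<lambda>(s, t). (if s = t then 1 else 0) + (\<Sum>i\<in>I n. u i s * u i t))" for n
  have uu: "u (k, j) s * u (k, j) t = \<mu> k / v * (Y j k (xs ! s) * Y j k (xs ! t))" for k j s t
  proof -
    have "u (k, j) s * u (k, j) t = (sqrt (\<mu> k / v) * sqrt (\<mu> k / v)) * (Y j k (xs ! s) * Y j k (xs ! t))"
      by (simp only: u_def prod.case mult_ac)
    also have "sqrt (\<mu> k / v) * sqrt (\<mu> k / v) = \<mu> k / v"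
      using mu[of k] v by simp
    finally show ?thesis .
  qed
  have sum_sq: "(\<Sum>j=1..?N k. \<Sum>t<?T. (u (k, j) t)\<^sup>2) \<le> real ?T / v * (\<mu> k * real (?N k))" for k
  proof -
    have "(\<Sum>j=1..?N k. \<Sum>t<?T. (u (k, j) t)\<^sup>2) = (\<Sum>t<?T. \<mu> k / v * (\<Sum>j=1..?N k. (Y j k (xs ! t))\<^sup>2))"
      unfolding sum_distrib_left power2_eq_square uu by (rule sum.swap)
    also have "\<dots> \<le> (\<Sum>t<?T. \<mu> k / v * real (?N k))"
      using mu[of k] v norm by (intro sum_mono mult_left_mono sum_spherical_harmonics_sq_le[OF Y]) auto
    finally show ?thesis by simp
  qed
  \<comment> \<open>A crude bound: a single feature is estimated by all features of its degree
    together.\<close>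
  have one_sq: "(\<Sum>t<?T. (u (k, j) t)\<^sup>2) \<le> real ?T * \<kappa> / v" if "j \<in> {1..?N k}" for k j
  proof -
    have "(\<Sum>t<?T. (u (k, j) t)\<^sup>2) \<le> (\<Sum>j=1..?N k. \<Sum>t<?T. (u (k, j) t)\<^sup>2)"
      by (rule member_le_sum[OF that]) (auto intro: sum_nonneg)
    also have "\<dots> \<le> real ?T / v * (\<mu> k * real (?N k))" by (rule sum_sq)
    also have "\<dots> \<le> real ?T / v * \<kappa>" using v by (intro mult_left_mono \<kappa>) auto
    finally show ?thesis by simp
  qed
  have lim: "(\<lambda>n. Determinant.det (G n)) \<longlonglongrightarrow> Determinant.det (1\<^sub>m ?T + (1 / v) \<cdot>\<^sub>m kernel_matrix K xs)"
  proof -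
    have "(\<lambda>n. (if s = t then 1 else 0) + (\<Sum>i\<in>I n. u i s * u i t))
       \<longlonglongrightarrow> (if s = t then 1 else 0) + 1 / v * K (xs ! s) (xs ! t)" if "s < ?T" "t < ?T" for s t
    proof (intro tendsto_add tendsto_const)
      have "(\<Sum>i\<in>I n. u i s * u i t)
        = 1 / v * (\<Sum>k<n. \<mu> k * (\<Sum>j=1..?N k. Y j k (xs ! s) * Y j k (xs ! t)))" for n
      proof -
        have "(\<Sum>i\<in>I n. u i s * u i t) = (\<Sum>k<n. \<Sum>j=1..?N k. u (k, j) s * u (k, j) t)"
          unfolding I_def by (subst sum.Sigma) (auto simp: case_prod_unfold)
        then show ?thesis
          by (simp only: uu) (simp add: sum_distrib_left mult_ac)
      qed
      moreover have "(\<lambda>n. \<Sum>k<n. \<mu> k * (\<Sum>j=1..?N k. Y j k (xs ! s) * Y j k (xs ! t)))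
          \<longlonglongrightarrow> K (xs ! s) (xs ! t)"
        using K norm that unfolding mercer_decomposition_def sums_def by (simp only: mem_sphere_0)
      ultimately show "(\<lambda>n. \<Sum>i\<in>I n. u i s * u i t) \<longlonglongrightarrow> 1 / v * K (xs ! s) (xs ! t)"
        by (simp only: tendsto_mult tendsto_const)
    qed
    note tendsto_det[OF this]
    moreover have "1\<^sub>m ?T + (1 / v) \<cdot>\<^sub>m kernel_matrix K xs
      = Matrix.mat ?T ?T (\<lambda>(s, t). (if s = t then 1 else 0) + 1 / v * K (xs ! s) (xs ! t))"
      by (intro eq_matI) (auto simp: kernel_matrix_def)
    ultimately show ?thesis by (simp add: G_def)
  qed
  define b where "b = (1 + real ?T * \<kappa> / v) ^ (\<Sum>k<M. ?N k) * exp (real ?T * \<delta> / v)"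
  have b: "0 < b"
    using \<kappa>0 v unfolding b_def
    by (intro mult_pos_pos zero_less_power add_pos_nonneg) auto
  \<comment> \<open>The restriction to \<open>n \<ge> M\<close> lets the product be split at
    \<open>M\<close>; it is harmless in the limit.\<close>
  have upper: "Determinant.det (G n) \<le> b" if n: "n \<ge> M" for n
  proof -
    define f where "f k = (\<Prod>j=1..?N k. 1 + (\<Sum>t<?T. (u (k, j) t)\<^sup>2))" for k
    have f0: "0 \<le> f k" for k
      unfolding f_def by (intro prod_nonneg) (auto simp: sq0 add_nonneg_nonneg)
    have "Determinant.det (G n) \<le> (\<Prod>i\<in>I n. 1 + (\<Sum>t<?T. (u i t)\<^sup>2))"
      unfolding G_def by (rule conjunct2[OF det_one_plus_gram_bounds]) (simp add: I_def)
    also have "\<dots> = (\<Prod>k<n. f k)"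
      unfolding f_def I_def by (subst prod.Sigma) (auto simp: case_prod_unfold)
    also have "\<dots> = (\<Prod>k<M. f k) * (\<Prod>k=M..<n. f k)"
      using prod.atLeastLessThan_concat[of 0 M n f] n by (simp add: lessThan_atLeast0)
    also have "\<dots> \<le> (1 + real ?T * \<kappa> / v) ^ (\<Sum>k<M. ?N k) * exp (real ?T * \<delta> / v)"
    proof (intro mult_mono prod_nonneg ballI f0)
      have "f k \<le> (1 + real ?T * \<kappa> / v) ^ ?N k" for k
      proof -
        have "f k \<le> (\<Prod>j=1..?N k. 1 + real ?T * \<kappa> / v)"
          unfolding f_def by (intro prod_mono) (auto intro!: one_sq simp: sq0 add_nonneg_nonneg)
        then show ?thesis by simp
      qed
      then show "(\<Prod>k<M. f k) \<le> (1 + real ?T * \<kappa> / v) ^ (\<Sum>k<M. ?N k)"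
        unfolding power_sum by (intro prod_mono) (auto simp: f0)
      have "f k \<le> exp (real ?T / v * (\<mu> k * real (?N k)))" for k
      proof -
        have "f k \<le> (\<Prod>j=1..?N k. exp (\<Sum>t<?T. (u (k, j) t)\<^sup>2))"
          unfolding f_def by (intro prod_mono) (auto simp: sq0 add_nonneg_nonneg)
        also have "\<dots> = exp (\<Sum>j=1..?N k. \<Sum>t<?T. (u (k, j) t)\<^sup>2)"
          by (simp add: exp_sum)
        also have "\<dots> \<le> exp (real ?T / v * (\<mu> k * real (?N k)))"
          using sum_sq by simp
        finally show ?thesis .
      qed
      then have "(\<Prod>k=M..<n. f k) \<le> (\<Prod>k=M..<n. exp (real ?T / v * (\<mu> k * real (?N k))))"
        by (intro prod_mono) (auto simp: f0)
      also have "\<dots> = exp (real ?T / v * (\<Sum>k=M..<n. \<mu> k * real (?N k)))"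
        by (simp add: exp_sum sum_distrib_left)
      also have "\<dots> \<le> exp (real ?T / v * \<delta>)"
        using v by (simp add: mult_left_mono divide_right_mono \<delta>)
      finally show "(\<Prod>k=M..<n. f k) \<le> exp (real ?T * \<delta> / v)" by simp
    qed (use \<kappa>0 v in auto)
    finally show ?thesis by (simp add: b_def)
  qed
  have "1 \<le> Determinant.det (G n)" for n
    unfolding G_def by (rule conjunct1[OF det_one_plus_gram_bounds]) (simp add: I_def)
  then have ge1: "1 \<le> Determinant.det (1\<^sub>m ?T + (1 / v) \<cdot>\<^sub>m kernel_matrix K xs)"
    by (intro LIMSEQ_le_const[OF lim]) auto
  then show "0 \<le> information_gain K v xs"
    by (simp add: information_gain_def)
  have "Determinant.det (1\<^sub>m ?T + (1 / v) \<cdot>\<^sub>m kernel_matrix K xs) \<le> b"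
    using upper by (intro LIMSEQ_le_const2[OF lim]) auto
  then have "ln (Determinant.det (1\<^sub>m ?T + (1 / v) \<cdot>\<^sub>m kernel_matrix K xs)) \<le> ln b"
    using ge1 b by simp
  also have "ln b = real (\<Sum>k<M. ?N k) * ln (1 + real ?T * \<kappa> / v) + real ?T * \<delta> / v"
  proof -
    have "0 < 1 + real ?T * \<kappa> / v" using \<kappa>0 v by (intro add_pos_nonneg) auto
    then show ?thesis unfolding b_def by (subst ln_mult) (auto simp: ln_realpow)
  qed
  finally show "information_gain K v xs \<le> 1 / 2 *
      (real (\<Sum>k<M. ?N k) * ln (1 + real ?T * \<kappa> / v) + real ?T * \<delta> / v)"
    by (simp add: information_gain_def)
qed

text \<open>The bounds on the gain depend on \<open>xs\<close> only through its length, so they hold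
  for the supremum. The absolute value is the form that the Landau symbol asks for.\<close>

lemma max_information_gain_bounds:
  fixes K :: "real ^ 'd::finite \<Rightarrow> real ^ 'd \<Rightarrow> real"
  assumes Y: "spherical_harmonics_basis Y" and K: "mercer_decomposition K \<mu> Y"
    and v: "0 < v" and X: "X \<subseteq> sphere 0 1" "X \<noteq> {}"
    and \<kappa>: "\<And>k. \<mu> k * real (num_harmonics CARD('d) k) \<le> \<kappa>"
    and \<delta>: "\<And>n. (\<Sum>k=M..<n. \<mu> k * real (num_harmonics CARD('d) k)) \<le> \<delta>"
  shows "\<bar>max_information_gain K v X T\<bar> \<le> 1 / 2 *
      (real (\<Sum>k<M. num_harmonics CARD('d) k) * ln (1 + real T * \<kappa> / v) + real T * \<delta> / v)"
proof -
  let ?S = "{xs. length xs = T \<and> set xs \<subseteq> X}"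
  let ?b = "1 / 2 * (real (\<Sum>k<M. num_harmonics CARD('d) k) * ln (1 + real T * \<kappa> / v) + real T * \<delta> / v)"
  obtain x where "x \<in> X" using X by blast
  \<comment> \<open>A constant sequence shows that the supremum ranges over a nonempty set.\<close>
  then have rep: "replicate T x \<in> ?S" by auto
  have gain: "0 \<le> information_gain K v xs" "information_gain K v xs \<le> ?b" if "xs \<in> ?S" for xs
    using information_gain_bounds[OF Y K v _ \<kappa> \<delta>, of xs] that X by auto
  have "max_information_gain K v X T \<le> ?b"
    unfolding max_information_gain_def using rep by (intro cSUP_least gain(2)) blast+
  moreover have "0 \<le> max_information_gain K v X T"
    unfolding max_information_gain_def using rep gain
    by (intro cSUP_upper2[OF _ rep] bdd_aboveI2[where M="?b"]) auto
  ultimately show ?thesis by simp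
qed

subsection \<open>Eigenvalue decay and the choice of the cut-off\<close>

text \<open>The constant is crude: the linear factor is at most \<open>(d + 2) * k\<close>, and the
  binomial coefficient is at most \<open>(d * k) ^ (d - 2)\<close>.\<close>

lemma num_harmonics_le:
  assumes d: "2 \<le> d" and k: "1 \<le> k"
  shows "num_harmonics d k \<le> (d + 2) * d ^ (d - 2) * k ^ (d - 2)"
proof -
  let ?b = "(k + d - 3) choose (d - 2)"
  have "(2 * k + d - 2) * ?b \<le> ((d + 2) * k) * ?b"
    using d k by (intro mult_right_mono) (auto simp: algebra_simps intro: le_trans[of _ "2 * k + d"])
  \<comment> \<open>Monotonicity of \<open>div\<close> suffices, so exactness of the division need
    not be shown.\<close>
  then have "(2 * k + d - 2) * ?b div k \<le> (((d + 2) * ?b) * k) div k"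
    by (intro div_le_mono) (simp only: mult_ac)
  then have "num_harmonics d k \<le> (((d + 2) * ?b) * k) div k"
    using k by (simp only: num_harmonics_def split: if_splits) simp
  also have "\<dots> = (d + 2) * ?b"
    using k by simp
  also have "\<dots> \<le> (d + 2) * (d * k) ^ (d - 2)"
  proof (rule mult_left_mono)
    have "k + d - 3 \<le> d * k"
    proof -
      obtain d' k' where "d = Suc d'" "k = Suc k'" using d k by (metis Suc_le_D Suc_1 One_nat_def)
      then show ?thesis by simp
    qed
    moreover have "?b \<le> (k + d - 3) ^ (d - 2)"
      using d k by (intro binomial_le_pow) auto
    ultimately show "?b \<le> (d * k) ^ (d - 2)" by (meson le_trans power_mono zero_le)
  qed simp
  finally show ?thesis
    by (simp only: power_mult_distrib mult_ac)
qed

text \<open>Telescoping with \<open>1 / n\<^sup>2 \<le> 2 * (1 / n - 1 / (n + 1))\<close>, which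
  follows from \<open>n + 1 \<le> 2 * n\<close>. The factor 2 allows the sum to start at
  \<open>M = 1\<close>, where comparison with \<open>1 / (n - 1) - 1 / n\<close> breaks
  down.\<close>

lemma sum_inverse_squares_tail_le:
  assumes "1 \<le> M"
  shows "(\<Sum>k=M..<n. 1 / (real k)\<^sup>2) \<le> 2 / real M"
proof (cases "M \<le> n")
  case True
  then have "(\<Sum>k=M..<n. 1 / (real k)\<^sup>2) \<le> 2 * (1 / real M - 1 / real n)"
  proof (induction n rule: dec_induct)
    case (step n)
    have n: "1 \<le> real n" using step(1) assms by linarith
    have "1 / (real n)\<^sup>2 = 2 / (2 * (real n * real n))"
      by (simp add: power2_eq_square)
    also have "\<dots> \<le> 2 / (real n * (real n + 1))"
      using n mult_left_mono[of "real n + 1" "2 * real n" "real n"] by (intro divide_left_mono) auto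
    also have "\<dots> = 2 * (1 / real n - 1 / real (Suc n))"
      using n by (simp add: field_simps)
    finally have "1 / (real n)\<^sup>2 \<le> 2 * (1 / real n - 1 / real (Suc n))" .
    then show ?case
      using step by simp
  qed simp
  also have "\<dots> \<le> 2 / real M" by simp
  finally show ?thesis .
qed simp

text \<open>Bernoulli's inequality. It pulls the constant \<open>\<kappa>\<close> out of the
  logarithm.\<close>

lemma ln_one_plus_mult_le:
  fixes a :: real
  assumes "0 \<le> a" "1 \<le> n"
  shows "ln (1 + real n * a) \<le> real n * ln (1 + a)"
proof -
  have "1 + real n * a \<le> (1 + a) ^ n"
    using assms by (intro Bernoulli_inequality) auto
  then have "ln (1 + real n * a) \<le> ln ((1 + a) ^ n)"
    using assms by (intro ln_mono) (auto intro: add_pos_nonneg)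
  then show ?thesis
    using assms by (simp add: ln_realpow)
qed

text \<open>The upper limit puts all but finitely many terms below \<open>C + 1\<close>; the sum of
  the remaining ones absorbs the rest.\<close>

lemma eigenvalue_decay_bound:
  assumes "eigenvalue_decay \<mu> d C" and mu: "\<And>k. 0 \<le> \<mu> k"
  obtains B where "0 < B" "\<And>k. real k ^ d * \<mu> k \<le> B"
proof -
  have "0 < C" "limsup (\<lambda>k. ereal (real k ^ d * \<mu> k)) < ereal (C + 1)"
    using assms by (auto simp: eigenvalue_decay_def)
  then obtain k0 where k0: "\<And>k. k \<ge> k0 \<Longrightarrow> real k ^ d * \<mu> k < C + 1"
    using Limsup_lessD by (fastforce simp: eventually_sequentially)
  define S where "S = (\<Sum>k<k0. real k ^ d * \<mu> k)"
  have "0 \<le> S" unfolding S_def using mu by (intro sum_nonneg) auto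
  have bound: "real k ^ d * \<mu> k \<le> C + 1 + S" for k
  proof (cases "k < k0")
    case True
    then have "real k ^ d * \<mu> k \<le> S"
      unfolding S_def using mu by (intro member_le_sum) auto
    then show ?thesis using \<open>0 < C\<close> by simp
  qed (use k0[of k] \<open>0 \<le> S\<close> in auto)
  show ?thesis
    by (rule that[OF _ bound]) (use \<open>0 < C\<close> \<open>0 \<le> S\<close> in auto)
qed

text \<open>The constant \<open>c\<close> is fixed before \<open>M\<close> and \<open>T\<close>, so
  the cut-off may afterwards be chosen depending on \<open>T\<close>.\<close>

lemma max_information_gain_decay_bound:
  fixes K :: "real ^ 'd::finite \<Rightarrow> real ^ 'd \<Rightarrow> real"
  assumes d: "2 \<le> CARD('d)" and Y: "spherical_harmonics_basis Y" and K: "mercer_decomposition K \<mu> Y"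
    and decay: "eigenvalue_decay \<mu> CARD('d) C"
    and v: "0 < v" and X: "X \<subseteq> sphere 0 1" "X \<noteq> {}"
  obtains c where "0 < c"
    "\<And>M T. 1 \<le> M \<Longrightarrow> \<bar>max_information_gain K v X T\<bar>
       \<le> c * (real M ^ (CARD('d) - 1) * ln (1 + real T / v) + real T / real M)"
proof -
  let ?d = "CARD('d)" and ?N = "num_harmonics CARD('d)"
  have mu: "0 \<le> \<mu> k" for k
    using K by (simp add: mercer_decomposition_def)
  obtain B where B: "0 < B" "\<And>k. real k ^ ?d * \<mu> k \<le> B"
    using eigenvalue_decay_bound[OF decay mu] by blast
  define a where "a = (?d + 2) * ?d ^ (?d - 2)"
  have N: "?N k \<le> a * k ^ (?d - 2)" if "1 \<le> k" for k
    using num_harmonics_le[OF d that] by (simp add: a_def)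
  have mu_N: "\<mu> k * real (?N k) \<le> B * a * (1 / (real k)\<^sup>2)" if k: "1 \<le> k" for k
  proof -
    have "\<mu> k * real (?N k) \<le> \<mu> k * (real a * real k ^ (?d - 2))"
      using N[OF k] mu by (intro mult_left_mono) (auto simp flip: of_nat_mult of_nat_power)
    also have "\<dots> = real a * (real k ^ ?d * \<mu> k) * (1 / (real k)\<^sup>2)"
      using k d by (simp add: power_diff)
    also have "\<dots> \<le> real a * B * (1 / (real k)\<^sup>2)"
      by (intro mult_right_mono mult_left_mono B) auto
    finally show ?thesis by (simp add: mult_ac)
  qed
  \<comment> \<open>Degree 0 enters separately: the bound \<open>B\<close> says nothing about
    \<open>\<mu> 0\<close>, as its factor \<open>0 ^ d\<close> vanishes.\<close>
  obtain n where n: "max (\<mu> 0 * real (?N 0)) (B * real a) \<le> real n"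
    using real_arch_simple by blast
  \<comment> \<open>A positive natural number, as the multiplier in
    \<open>ln_one_plus_mult_le\<close> has to be.\<close>
  define \<kappa> where "\<kappa> = Suc n"
  have \<kappa>: "\<mu> k * real (?N k) \<le> real \<kappa>" for k
  proof (cases "k = 0")
    case False
    then have "\<mu> k * real (?N k) \<le> B * a * (1 / (real k)\<^sup>2)" by (intro mu_N) auto
    also have "\<dots> \<le> B * a * 1"
      using B(1) False by (intro mult_left_mono) (auto simp: field_simps)
    finally show ?thesis using n by (simp add: \<kappa>_def)
  qed (use n in \<open>simp add: \<kappa>_def\<close>)
  have tail: "(\<Sum>k=M..<n. \<mu> k * real (?N k)) \<le> B * a * (2 / real M)" if M: "1 \<le> M" for M n
  proof -
    have "(\<Sum>k=M..<n. \<mu> k * real (?N k)) \<le> (\<Sum>k=M..<n. B * a * (1 / (real k)\<^sup>2))"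
      using M by (intro sum_mono mu_N) auto
    also have "\<dots> \<le> B * a * (2 / real M)"
      unfolding sum_distrib_left[symmetric]
      using B(1) by (intro mult_left_mono sum_inverse_squares_tail_le[OF M]) auto
    finally show ?thesis .
  qed
  \<comment> \<open>The summand 1 in the constant pays for degree 0, where there is one harmonic but
    \<open>a * k ^ (d - 2)\<close> may vanish.\<close>
  have dim: "real (\<Sum>k<M. ?N k) \<le> (1 + real a) * real M ^ (?d - 1)" if M: "1 \<le> M" for M
  proof -
    have "?N k \<le> (1 + a) * M ^ (?d - 2)" if "k < M" for k
    proof (cases "k = 0")
      case False
      then have "?N k \<le> a * k ^ (?d - 2)" by (intro N) simp
      also have "\<dots> \<le> (1 + a) * M ^ (?d - 2)"
        using that by (intro mult_mono power_mono) auto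
      finally show ?thesis .
    next
      case True
      have "1 * 1 \<le> (1 + a) * M ^ (?d - 2)"
        using M by (intro mult_le_mono) auto
      then show ?thesis using True by (simp add: num_harmonics_def)
    qed
    then have "(\<Sum>k<M. ?N k) \<le> (\<Sum>k<M. (1 + a) * M ^ (?d - 2))"
      by (intro sum_mono) auto
    also have "\<dots> = (1 + a) * M ^ (?d - 1)"
    proof -
      have "?d - 1 = Suc (?d - 2)" using d by simp
      then show ?thesis by (simp add: algebra_simps)
    qed
    finally have "real (\<Sum>k<M. ?N k) \<le> real ((1 + a) * M ^ (?d - 1))"
      by (simp only: of_nat_le_iff)
    then show ?thesis by (simp add: distrib_right)
  qed
  define c where "c = (1 + real a) * real \<kappa> + 2 * B * a / v"
  have "0 < c"
    using B v by (auto simp: c_def \<kappa>_def intro!: add_pos_nonneg mult_pos_pos)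
  moreover have "\<bar>max_information_gain K v X T\<bar>
       \<le> c * (real M ^ (?d - 1) * ln (1 + real T / v) + real T / real M)" if M: "1 \<le> M" for M T
  proof -
    let ?l = "ln (1 + real T / v)"
    have l: "0 \<le> ?l" using v by simp
    have ln: "ln (1 + real T * real \<kappa> / v) \<le> real \<kappa> * ?l"
      using ln_one_plus_mult_le[of "real T / v" \<kappa>] v by (simp add: \<kappa>_def mult_ac)
    have "\<bar>max_information_gain K v X T\<bar> \<le> 1 / 2 *
      (real (\<Sum>k<M. ?N k) * ln (1 + real T * real \<kappa> / v) + real T * (B * a * (2 / real M)) / v)"
      by (rule max_information_gain_bounds[OF Y K v X \<kappa> tail[OF M]])
    also have "\<dots> \<le> 1 * (real (\<Sum>k<M. ?N k) * ln (1 + real T * real \<kappa> / v) + real T * (B * a * (2 / real M)) / v)"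
      using v B(1) by (intro mult_right_mono add_nonneg_nonneg mult_nonneg_nonneg divide_nonneg_pos)
        (use M in \<open>auto intro: sum_nonneg\<close>)
    also have "\<dots> \<le> 1 * (((1 + real a) * real M ^ (?d - 1)) * (real \<kappa> * ?l) + (2 * B * a / v) * (real T / real M))"
      using v by (intro mult_left_mono add_mono mult_mono dim[OF M] ln) (auto simp: mult_ac)
    also have "\<dots> \<le> c * (real M ^ (?d - 1) * ?l) + c * (real T / real M)"
    proof -
      have "((1 + real a) * real M ^ (?d - 1)) * (real \<kappa> * ?l) = ((1 + real a) * real \<kappa>) * (real M ^ (?d - 1) * ?l)"
        by (simp only: mult_ac)
      also have "\<dots> \<le> c * (real M ^ (?d - 1) * ?l)"
        using l B v by (intro mult_right_mono) (auto simp: c_def)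
      finally have "((1 + real a) * real M ^ (?d - 1)) * (real \<kappa> * ?l) \<le> c * (real M ^ (?d - 1) * ?l)" .
      moreover have "(2 * B * a / v) * (real T / real M) \<le> c * (real T / real M)"
        by (intro mult_right_mono) (auto simp: c_def)
      ultimately show ?thesis unfolding mult_1 by (rule add_mono)
    qed
    finally show ?thesis by (simp only: distrib_left)
  qed
  ultimately show ?thesis by (rule that)
qed

theorem theorem3p1:
  fixes K :: "real ^ 'd::finite \<Rightarrow> real ^ 'd \<Rightarrow> real"
    and X :: "(real ^ 'd) set"
    and L :: nat
    and \<sigma> C :: real
    and \<mu> :: "nat \<Rightarrow> real"
    and Y :: "nat \<Rightarrow> nat \<Rightarrow> real ^ 'd \<Rightarrow> real"
  assumes "2 \<le> CARD('d)"
    and "1 \<le> L"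
    and "is_ntk L K"
    and "spherical_harmonics_basis Y"
    and "mercer_decomposition K \<mu> Y"
    and "eigenvalue_decay \<mu> CARD('d) C"
    and "X \<subseteq> sphere 0 1"
    and "X \<noteq> {}"
    and "0 < \<sigma>\<^sup>2"
  shows "(\<lambda>T. max_information_gain K (\<sigma>\<^sup>2) X T) \<in>
    O(\<lambda>T. (C * real T / ln (1 + real T / \<sigma>\<^sup>2)) powr ((real CARD('d) - 1) / real CARD('d)) *
           ln (1 + real T / \<sigma>\<^sup>2 *
             (C * real T / ln (1 + real T / \<sigma>\<^sup>2)) powr ((real CARD('d) - 1) / real CARD('d))))"
proof -
  let ?d = "CARD('d)"
  define v where "v = \<sigma>\<^sup>2"
  have v: "0 < v" using assms(9) by (simp add: v_def)
  have C: "0 < C" using assms(6) by (simp add: eigenvalue_decay_def)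
  \<comment> \<open>\<open>s T\<close> is the target for \<open>M ^ d\<close>, and so
    \<open>P T\<close> is the target for \<open>M ^ (d - 1)\<close>.\<close>
  define s where "s T = C * real T / ln (1 + real T / v)" for T :: nat
  define P where "P T = s T powr ((real ?d - 1) / real ?d)" for T
  obtain c where c: "0 < c"
    "\<And>M T. 1 \<le> M \<Longrightarrow> \<bar>max_information_gain K v X T\<bar>
       \<le> c * (real M ^ (?d - 1) * ln (1 + real T / v) + real T / real M)"
    using max_information_gain_decay_bound[OF assms(1,4,5,6) v assms(7,8)] by blast
  have "filterlim s at_top at_top"
    unfolding s_def using C v by real_asymp
  then have ev: "eventually (\<lambda>T. 1 \<le> s T) at_top"
    by (simp add: filterlim_at_top)
  have "\<bar>max_information_gain K v X T\<bar> \<le> c * (2 ^ (?d - 1) + 1 / C) * \<bar>P T * ln (1 + real T / v * P T)\<bar>"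
    if s: "1 \<le> s T" and T: "1 \<le> T" for T
  proof -
    let ?l = "ln (1 + real T / v)"
    \<comment> \<open>The ideal real cut-off, with \<open>r ^ d = s T\<close>. Since
      \<open>r\<close> is at least 1, rounding up to \<open>M\<close> costs at most a factor
      2.\<close>
    define r where "r = s T powr (1 / real ?d)"
    define M where "M = nat \<lceil>r\<rceil>"
    have l: "0 < ?l" using v T by (intro ln_gt_zero) simp
    have r: "1 \<le> r" unfolding r_def using s by (simp add: ge_one_powr_ge_zero)
    then have M: "1 \<le> M" "r \<le> real M" "real M \<le> 2 * r"
      unfolding M_def by linarith+
    have P1: "1 \<le> P T" unfolding P_def using s by (intro ge_one_powr_ge_zero) auto
    have rP: "r ^ (?d - 1) = P T"
      using s r by (simp add: r_def P_def powr_realpow[symmetric] powr_powr of_nat_diff)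
    have "real M ^ (?d - 1) \<le> (2 * r) ^ (?d - 1)"
      using M by (intro power_mono) auto
    then have MP: "real M ^ (?d - 1) \<le> 2 ^ (?d - 1) * P T"
      unfolding power_mult_distrib rP .
    \<comment> \<open>This identity is the balance of the two terms: it turns \<open>T / r\<close>
      into the multiple \<open>1 / C\<close> of \<open>P T * ln (1 + T / v)\<close>.\<close>
    have "r * P T = s T powr (1 / real ?d + (real ?d - 1) / real ?d)"
      by (simp add: r_def P_def powr_add)
    also have "1 / real ?d + (real ?d - 1) / real ?d = 1"
      by (simp add: field_simps)
    finally have rPs: "r * P T = s T" using s by simp
    have "real T / real M \<le> real T / r"
      using M r by (intro divide_left_mono) auto
    also have "\<dots> = s T * ?l / C / r"
      using l C by (simp add: s_def)
    also have "\<dots> = 1 / C * (P T * ?l)"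
      using r by (simp flip: rPs)
    finally have TM: "real T / real M \<le> 1 / C * (P T * ?l)" .
    have "\<bar>max_information_gain K v X T\<bar> \<le> c * (real M ^ (?d - 1) * ?l + real T / real M)"
      by (rule c(2)[OF M(1)])
    also have "\<dots> \<le> c * (2 ^ (?d - 1) * P T * ?l + 1 / C * (P T * ?l))"
      using c(1) l by (intro mult_left_mono add_mono mult_right_mono MP TM) auto
    also have "\<dots> = c * (2 ^ (?d - 1) + 1 / C) * (P T * ?l)"
      by (simp add: algebra_simps)
    \<comment> \<open>The argument so far gives the smaller logarithm \<open>ln (1 + T / v)\<close>;
      the claimed one is larger because \<open>P T\<close> is at least 1.\<close>
    also have "\<dots> \<le> c * (2 ^ (?d - 1) + 1 / C) * (P T * ln (1 + real T / v * P T))"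
    proof (intro mult_left_mono)
      have "real T / v * 1 \<le> real T / v * P T"
        using P1 v by (intro mult_left_mono) auto
      then show "?l \<le> ln (1 + real T / v * P T)"
        using v by (intro ln_mono) (auto intro: add_pos_nonneg)
    qed (use c(1) C P1 in auto)
    also have "\<dots> \<le> c * (2 ^ (?d - 1) + 1 / C) * \<bar>P T * ln (1 + real T / v * P T)\<bar>"
      using c(1) C by (intro mult_left_mono) auto
    finally show ?thesis .
  qed
  then have "eventually (\<lambda>T. norm (max_information_gain K v X T)
      \<le> c * (2 ^ (?d - 1) + 1 / C) * norm (P T * ln (1 + real T / v * P T))) at_top"
    using eventually_conj[OF ev eventually_ge_at_top[of 1]] by (auto elim!: eventually_mono)
  then have "(\<lambda>T. max_information_gain K v X T) \<in> O(\<lambda>T. P T * ln (1 + real T / v * P T))"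
    by (rule bigoI)
  then show ?thesis
    by (simp add: P_def s_def v_def)
qed

end
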